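(* Let $p\ge1$, let $\varphi:\mathbb{R}^n\times\mathbb{R}^{n_1}\times\dots\times\mathbb{R}^{n_p}\to\mathbb{R}^n$ be Lipschitz continuous in each of its arguments with constants $L_j$ ($j=0,\dots,p$), and let the solution maps $(\mathbf{x},\mathbf{u}_1,\dots,\mathbf{u}_{j-1})\mapsto\mathbf{u}_j$ be Lipschitz continuous with respect to each of their arguments with constants $K_{j,\ell}$ ($j=1,\dots,p$, $\ell=0,\dots,j-1$). Let $G(\mathbf{x})=\varphi(\mathbf{x},\mathbf{u}_1,\dots,\mathbf{u}_p)$. Fix $i\in\{1,\dots,p\}$ and let $G_k$ be the inexact operator obtained by making the approximation $\mathbf{u}_i\approx\widehat{\mathbf{u}}_i$ with a projection-based reduced-order model. Then $$\delta^{k+1}_{i,p}=\left(L_i+\sum_{j=i+1}^pL_j\sum_{\sigma\in d_{i,j}}\prod_{m=1}^{|\sigma|-1}K_{\sigma_m,\sigma_{m+1}}\right)\|A_i^{-1}(\mu_i^{k+1})\|\,\|r_i(\mu_i^{k+1},\widehat{\mathbf{u}}_i^{k+1})\|$$ is an upper bound on the approximation error, i.e. $\|G(\mathbf{x}^k)-G_k(\mathbf{x}^k)\|\le\delta^{k+1}_{i,p}$, where $\mathbf{x}^k$ is the current iterate at which the operators are evaluated.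
   Context: For $i=1,\dots,p$, the vector $\mathbf{u}_i\in\mathbb{R}^{n_i}$ is the solution of a linear system whose data depend on $\mathbf{x}\in\mathbb{R}^n$ and on the previous solutions: $\mathbf{u}_i=A_i^{-1}F_i$, with $A_i=A_i(\mathbf{x},\mathbf{u}_1,\dots,\mathbf{u}_{i-1})\in\mathrm{GL}_{n_i}(\mathbb{R})$ and $F_i=F_i(\mathbf{x},\mathbf{u}_1,\dots,\mathbf{u}_{i-1})\in\mathbb{R}^{n_i}$. This defines the solution maps $(\mathbf{x},\mathbf{u}_1,\dots,\mathbf{u}_{i-1})\mapsto\mathbf{u}_i$. In $G(\mathbf{x})=\varphi(\mathbf{x},\mathbf{u}_1,\dots,\mathbf{u}_p)$ the $\mathbf{u}_i$ are computed recursively from $\mathbf{x}$. Write $\mu_i^{k+1}=(\mathbf{x}^k,\mathbf{u}_1^{k+1},\dots,\mathbf{u}_{i-1}^{k+1})$, where $\mathbf{u}_j^{k+1}$ are the solutions computed from $\mathbf{x}^k$ at the current iteration. Norms are Euclidean, with the induced operator norm for matrices. "Lipschitz continuous in an argument with constant $c$" means $c$-Lipschitz in that argument when the others are held fixed, uniformly over the values of the others; $L_0$, $K_{j,0}$ refer to the argument $\mathbf{x}$, and $L_j$, $K_{j,\ell}$ ($j,\ell\ge1$) to $\mathbf{u}_j$, $\mathbf{u}_\ell$ respectively. $d_{i,j}$ is the set of strictly decreasing integer sequences $\sigma=(\sigma_1,\dots,\sigma_{|\sigma|})$ with $\sigma_1=j$ and $\sigma_{|\sigma|}=i$; $|\sigma|$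 is the number of terms. Reduced-order model (ROM) approximation: given a reduced basis matrix $V\in\mathbb{R}^{n_i\times P}$ and mean snapshot $\overline{u}\in\mathbb{R}^{n_i}$ built from previous iterations, $\widehat{\mathbf{u}}_i=V\alpha+\overline{u}$, where $\alpha\in\mathbb{R}^P$ solves $V^\top A_i(\mu_i)V\alpha=V^\top F_i(\mu_i)-V^\top A_i(\mu_i)\overline{u}$ (assumed solvable). The residual is $r_i(\mu,\widehat{\mathbf{u}})=F_i(\mu)-A_i(\mu)\widehat{\mathbf{u}}$. Inexact operator: $G_k(\mathbf{x})=\varphi(\mathbf{x},\mathbf{u}_1,\dots,\mathbf{u}_{i-1},\widehat{\mathbf{u}}_i,\dots,\widehat{\mathbf{u}}_p)$, where $\mathbf{u}_1,\dots,\mathbf{u}_{i-1}$ are exact, $\widehat{\mathbf{u}}_i$ is the ROM approximation, and the subsequent perturbed solutions are defined recursively by solving the remaining systems exactly with perturbed data: $\widehat{\mathbf{u}}_{j}=\mathbf{u}_{j}(\mathbf{x},\mathbf{u}_1,\dots,\mathbf{u}_{i-1},\widehat{\mathbf{u}}_i,\dots,\widehat{\mathbf{u}}_{j-1})$ for $j>i$. *)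

theory Defs
  imports Complex_Main "HOL-Library.FuncSet" "Jordan_Normal_Form.Gauss_Jordan_Elimination"
begin

text \<open>
  The spaces \<open>\<real>^(n_i)\<close>, \<open>i = 1, \<dots>, p\<close>, form a family whose length varies, so vectors and
  matrices are those of Jordan_Normal_Form, with dimensions given by a function \<open>d\<close>:
  \<open>d 0\<close> is the dimension \<open>n\<close> of \<open>x\<close> and \<open>d j\<close> is \<open>n_j\<close> for \<open>j \<ge> 1\<close>.
\<close>

definition vnorm :: "real vec \<Rightarrow> real" where
  "vnorm v = sqrt (v \<bullet> v)"

definition opnorm :: "real mat \<Rightarrow> real" where
  "opnorm M = (SUP v \<in> {v \<in> carrier_vec (dim_col M). vnorm v \<le> 1}. vnorm (M *\<^sub>v v))"

definition minv :: "real mat \<Rightarrow> real mat" where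
  "minv M = the (mat_inverse M)"

text \<open>
  Tuples \<open>(x, u_1, \<dots>, u_(m-1))\<close> are functions on the indices below \<open>m\<close>; the index \<open>0\<close>
  refers to \<open>x\<close>. They are extensional, so a function of such a tuple depends on these \<open>m\<close>
  entries only.
\<close>

definition args :: "(nat \<Rightarrow> nat) \<Rightarrow> nat \<Rightarrow> (nat \<Rightarrow> real vec) set" where
  "args d m = (\<Pi>\<^sub>E j\<in>{..<m}. carrier_vec (d j))"

text \<open>As in the library's \<open>lipschitz_on\<close>, a Lipschitz constant is nonnegative by definition.\<close>

definition lipschitz_in_arg ::
  "(nat \<Rightarrow> real vec) set \<Rightarrow> nat \<Rightarrow> real \<Rightarrow> ((nat \<Rightarrow> real vec) \<Rightarrow> real vec) \<Rightarrow> bool" where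
  "lipschitz_in_arg D j c f \<longleftrightarrow>
     0 \<le> c \<and>
     (\<forall>z\<in>D. \<forall>w\<in>D. (\<forall>l. l \<noteq> j \<longrightarrow> z l = w l) \<longrightarrow> vnorm (f z - f w) \<le> c * vnorm (z j - w j))"

definition sol_map ::
  "(nat \<Rightarrow> (nat \<Rightarrow> real vec) \<Rightarrow> real mat) \<Rightarrow> (nat \<Rightarrow> (nat \<Rightarrow> real vec) \<Rightarrow> real vec) \<Rightarrow>
   nat \<Rightarrow> (nat \<Rightarrow> real vec) \<Rightarrow> real vec" where
  "sol_map A F j \<mu> = minv (A j \<mu>) *\<^sub>v F j \<mu>"

text \<open>
  \<open>chain S x m\<close> is the tuple \<open>(x, u_1, \<dots>, u_m)\<close> computed recursively by
  \<open>u_j = S j (x, u_1, \<dots>, u_(j-1))\<close>.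
\<close>

primrec chain ::
  "(nat \<Rightarrow> (nat \<Rightarrow> real vec) \<Rightarrow> real vec) \<Rightarrow> real vec \<Rightarrow> nat \<Rightarrow> (nat \<Rightarrow> real vec)" where
  "chain S x 0 = (\<lambda>j\<in>{0}. x)"
| "chain S x (Suc m) = (chain S x m)(Suc m := S (Suc m) (chain S x m))"

definition composite ::
  "((nat \<Rightarrow> real vec) \<Rightarrow> real vec) \<Rightarrow> (nat \<Rightarrow> (nat \<Rightarrow> real vec) \<Rightarrow> real vec) \<Rightarrow> nat \<Rightarrow>
   real vec \<Rightarrow> real vec" where
  "composite \<phi> S p x = \<phi> (chain S x p)"

text \<open>\<open>a\<close> solves the reduced system of the full system with matrix \<open>M\<close> and right-hand side \<open>f\<close>.\<close>

definition solves_reduced ::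
  "real mat \<Rightarrow> real vec \<Rightarrow> real mat \<Rightarrow> real vec \<Rightarrow> real vec \<Rightarrow> bool" where
  "solves_reduced M f V ub a \<longleftrightarrow>
     a \<in> carrier_vec (dim_col V) \<and>
     (transpose_mat V * M * V) *\<^sub>v a =
       transpose_mat V *\<^sub>v f - (transpose_mat V * M) *\<^sub>v ub"

text \<open>\<open>\<alpha> \<mu>\<close> are the reduced coordinates at \<open>\<mu>\<close>.\<close>

definition rom_map ::
  "real mat \<Rightarrow> real vec \<Rightarrow> ((nat \<Rightarrow> real vec) \<Rightarrow> real vec) \<Rightarrow> (nat \<Rightarrow> real vec) \<Rightarrow> real vec" where
  "rom_map V ub \<alpha> \<mu> = V *\<^sub>v \<alpha> \<mu> + ub"

text \<open>
  Replacing the \<open>i\<close>-th solution map only: entries before \<open>i\<close> remain exact, and later systems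
  are solved exactly with the perturbed data.
\<close>

definition inexact ::
  "((nat \<Rightarrow> real vec) \<Rightarrow> real vec) \<Rightarrow> (nat \<Rightarrow> (nat \<Rightarrow> real vec) \<Rightarrow> real vec) \<Rightarrow> nat \<Rightarrow>
   nat \<Rightarrow> ((nat \<Rightarrow> real vec) \<Rightarrow> real vec) \<Rightarrow> real vec \<Rightarrow> real vec" where
  "inexact \<phi> S p i R = composite \<phi> (S(i := R)) p"

definition residual ::
  "(nat \<Rightarrow> (nat \<Rightarrow> real vec) \<Rightarrow> real mat) \<Rightarrow> (nat \<Rightarrow> (nat \<Rightarrow> real vec) \<Rightarrow> real vec) \<Rightarrow>
   nat \<Rightarrow> (nat \<Rightarrow> real vec) \<Rightarrow> real vec \<Rightarrow> real vec" where
  "residual A F i \<mu> v = F i \<mu> - A i \<mu> *\<^sub>v v"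

text \<open>
  Strictly decreasing sequences from \<open>j\<close> down to \<open>i\<close>. Their terms lie between \<open>i\<close> and \<open>j\<close>, so
  natural numbers suffice. List positions start at \<open>0\<close>: \<open>\<sigma>_m\<close> is \<open>\<sigma> ! (m - 1)\<close>.
\<close>

definition dec_seqs :: "nat \<Rightarrow> nat \<Rightarrow> nat list set" where
  "dec_seqs i j = {\<sigma>. \<sigma> \<noteq> [] \<and> sorted_wrt (>) \<sigma> \<and> hd \<sigma> = j \<and> last \<sigma> = i}"

definition error_bound ::
  "(nat \<Rightarrow> real) \<Rightarrow> (nat \<Rightarrow> nat \<Rightarrow> real) \<Rightarrow> nat \<Rightarrow> nat \<Rightarrow> real mat \<Rightarrow> real vec \<Rightarrow> real" where
  "error_bound L K i p M r =
     (L i + (\<Sum>j = i+1..p. L j *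
        (\<Sum>\<sigma>\<in>dec_seqs i j. \<Prod>m = 1..length \<sigma> - 1. K (\<sigma> ! (m - 1)) (\<sigma> ! m))))
     * opnorm (minv M) * vnorm r"

end

theory Submission
  imports Defs "HOL-Analysis.L2_Norm"
begin

text \<open>
  Let \<open>u\<close> be the exact tuple and \<open>v\<close> the perturbed one, and \<open>e j\<close> the distance of their
  \<open>j\<close>-th entries. The tuples agree before position \<open>i\<close>, so both evaluate system \<open>i\<close> at the
  same data \<open>\<mu>\<close>. With \<open>M = A i \<mu>\<close> and \<open>f = F i \<mu>\<close> the identity
  \<open>M\<inverse> f - v i = M\<inverse> (f - M (v i))\<close> bounds \<open>e i\<close> by \<open>\<parallel>M\<inverse>\<parallel>\<close> times the norm of the residual
  (\<open>solution_error_le_residual\<close>). After \<open>i\<close>, both entries come from the same solution map,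
  and changing its arguments one at a time (\<open>lipschitz_in_args_sum\<close>) gives
  \<open>e m \<le> (\<Sum>l = i..<m. K m l * e l)\<close>.

  Unrolling this recursion from \<open>j\<close> down to \<open>i\<close> means choosing, again and again, a smaller index
  \<open>l \<ge> i\<close>; the complete unrollings are the strictly decreasing sequences from \<open>j\<close> to \<open>i\<close>, each
  contributing the product of the constants met on its way. So \<open>e j \<le> gain K i j * e i\<close>, where
  \<open>gain\<close> is the sum over sequences (\<open>gain_rec\<close>, \<open>gain_gronwall\<close>). One more application of the
  one-argument-at-a-time estimate, to \<open>\<phi>\<close>, gives the bound.
\<close>

section \<open>The Euclidean norm and the operator norm\<close>

lemma vnorm_eq_L2_set: "vnorm v = L2_set (\<lambda>k. v $ k) {0..<dim_vec v}"
  by (simp add: vnorm_def L2_set_def scalar_prod_def power2_eq_square)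

lemma vnorm_nonneg: "0 \<le> vnorm v"
  by (simp add: vnorm_eq_L2_set)

lemma vnorm_minus_self: "vnorm (v - v) = 0"
  by (simp add: vnorm_eq_L2_set L2_set_def)

lemma vnorm_smult: "vnorm (c \<cdot>\<^sub>v v) = \<bar>c\<bar> * vnorm v"
  by (simp add: vnorm_def real_sqrt_mult)

lemma vnorm_triangle_diff:
  assumes "u \<in> carrier_vec n" "v \<in> carrier_vec n" "w \<in> carrier_vec n"
  shows "vnorm (u - w) \<le> vnorm (u - v) + vnorm (v - w)"
proof -
  have "vnorm (u - w) = L2_set (\<lambda>k. (u - v) $ k + (v - w) $ k) {0..<n}"
    using assms by (auto simp: vnorm_eq_L2_set intro!: L2_set_cong)
  also have "\<dots> \<le> L2_set (\<lambda>k. (u - v) $ k) {0..<n} + L2_set (\<lambda>k. (v - w) $ k) {0..<n}"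
    by (rule L2_set_triangle_ineq)
  finally show ?thesis
    using assms by (simp add: vnorm_eq_L2_set)
qed

lemma abs_index_le_vnorm:
  assumes "k < dim_vec v"
  shows "\<bar>v $ k\<bar> \<le> vnorm v"
proof -
  have "\<bar>v $ k\<bar> \<le> L2_set (\<lambda>k. \<bar>v $ k\<bar>) {0..<dim_vec v}"
    using assms by (intro member_le_L2_set) auto
  then show ?thesis
    by (simp add: vnorm_eq_L2_set L2_set_def)
qed

text \<open>
  The supremum defining the operator norm is over a bounded set: on the unit ball every entry of
  \<open>M v\<close> is at most the absolute row sum. Without this bound the real-valued supremum would carry
  no information.
\<close>

lemma bdd_above_unit_ball_image:
  "bdd_above ((\<lambda>v. vnorm (M *\<^sub>v v)) ` {v \<in> carrier_vec (dim_col M). vnorm v \<le> 1})"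
proof (rule bdd_aboveI2)
  fix v assume v: "v \<in> {v \<in> carrier_vec (dim_col M). vnorm v \<le> 1}"
  have "vnorm (M *\<^sub>v v) \<le> (\<Sum>r = 0..<dim_row M. \<bar>(M *\<^sub>v v) $ r\<bar>)"
    unfolding vnorm_eq_L2_set dim_mult_mat_vec by (rule L2_set_le_sum_abs)
  also have "\<dots> \<le> (\<Sum>r = 0..<dim_row M. \<Sum>c = 0..<dim_col M. \<bar>M $$ (r, c)\<bar>)"
  proof (rule sum_mono)
    fix r assume r: "r \<in> {0..<dim_row M}"
    have "(M *\<^sub>v v) $ r = (\<Sum>c = 0..<dim_col M. M $$ (r, c) * v $ c)"
      using r v by (auto simp: scalar_prod_def intro!: sum.cong)
    also have "\<bar>\<dots>\<bar> \<le> (\<Sum>c = 0..<dim_col M. \<bar>M $$ (r, c) * v $ c\<bar>)"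
      by (rule sum_abs)
    also have "\<dots> \<le> (\<Sum>c = 0..<dim_col M. \<bar>M $$ (r, c)\<bar>)"
    proof (rule sum_mono)
      fix c assume "c \<in> {0..<dim_col M}"
      then have "\<bar>v $ c\<bar> \<le> 1"
        using abs_index_le_vnorm[of c v] v by auto
      then show "\<bar>M $$ (r, c) * v $ c\<bar> \<le> \<bar>M $$ (r, c)\<bar>"
        by (simp add: abs_mult mult_left_le)
    qed
    finally show "\<bar>(M *\<^sub>v v) $ r\<bar> \<le> (\<Sum>c = 0..<dim_col M. \<bar>M $$ (r, c)\<bar>)" .
  qed
  finally show "vnorm (M *\<^sub>v v) \<le> (\<Sum>r = 0..<dim_row M. \<Sum>c = 0..<dim_col M. \<bar>M $$ (r, c)\<bar>)" .
qed

lemma vnorm_mult_mat_vec_le: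
  assumes M: "M \<in> carrier_mat m n" and v: "v \<in> carrier_vec n"
  shows "vnorm (M *\<^sub>v v) \<le> opnorm M * vnorm v"
proof (cases "vnorm v = 0")
  case True
  have "v = 0\<^sub>v n"
    using v abs_index_le_vnorm[of _ v] True by (intro eq_vecI) auto
  then have "vnorm (M *\<^sub>v v) = 0"
    using M by (simp add: vnorm_eq_L2_set L2_set_def)
  then show ?thesis
    using True by simp
next
  case False
  then have pos: "vnorm v > 0"
    using vnorm_nonneg[of v] by simp
  let ?w = "inverse (vnorm v) \<cdot>\<^sub>v v"
  have "vnorm ?w = 1"
    using pos by (simp add: vnorm_smult)
  then have "vnorm (M *\<^sub>v ?w) \<le> opnorm M"
    unfolding opnorm_def using M v by (intro cSUP_upper bdd_above_unit_ball_image) auto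
  moreover have "vnorm (M *\<^sub>v ?w) = inverse (vnorm v) * vnorm (M *\<^sub>v v)"
    using M v pos by (simp add: mult_mat_vec vnorm_smult)
  ultimately have "inverse (vnorm v) * vnorm (M *\<^sub>v v) \<le> opnorm M"
    by simp
  then show ?thesis
    using pos by (simp add: field_simps)
qed

section \<open>The error of one system is controlled by its residual\<close>

lemma minv_inverse:
  assumes M: "M \<in> carrier_mat n n" and inv: "invertible_mat M"
  shows "minv M \<in> carrier_mat n n" "minv M * M = 1\<^sub>m n"
proof -
  obtain B where B: "M * B = 1\<^sub>m n" "B * M = 1\<^sub>m (dim_row B)"
    using inv M unfolding invertible_mat_def inverts_mat_def by auto
  have "dim_col (M * B) = n" "dim_col (B * M) = dim_row B"
    using B by auto
  then have "B \<in> carrier_mat n n"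
    using M by auto
  then have "M \<in> Units (ring_mat TYPE(real) n ())"
    using B M unfolding Units_def by (auto simp: ring_mat_simps)
  then obtain C where C: "mat_inverse M = Some C"
    using mat_inverse(1)[OF M, where b = "()"] by (cases "mat_inverse M") auto
  show "minv M \<in> carrier_mat n n" "minv M * M = 1\<^sub>m n"
    using mat_inverse(2)[OF M C] C by (auto simp: minv_def)
qed

text \<open>
  The error of an approximation \<open>v\<close> of \<open>M\<inverse> f\<close> is the image of its residual under the inverse,
  \<open>M\<inverse> f - v = M\<inverse> (f - M v)\<close>.
\<close>

lemma solution_error_le_residual:
  assumes M: "M \<in> carrier_mat n n" and inv: "invertible_mat M"
    and f: "f \<in> carrier_vec n" and v: "v \<in> carrier_vec n"
  shows "vnorm (minv M *\<^sub>v f - v) \<le> opnorm (minv M) * vnorm (f - M *\<^sub>v v)"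
proof -
  note N = minv_inverse[OF M inv]
  have "minv M *\<^sub>v (f - M *\<^sub>v v) = minv M *\<^sub>v f - minv M *\<^sub>v (M *\<^sub>v v)"
    using N M f v by (intro mult_minus_distrib_mat_vec) auto
  also have "minv M *\<^sub>v (M *\<^sub>v v) = v"
    using N M v by (simp flip: assoc_mult_mat_vec)
  finally show ?thesis
    using vnorm_mult_mat_vec_le[OF N(1), of "f - M *\<^sub>v v"] M f v by simp
qed

section \<open>Lipschitz continuity in each argument\<close>

text \<open>
  Replacing the entries of \<open>z\<close> by those of \<open>w\<close> one position at a time changes a single argument
  per step, so each step is controlled by one of the constants; the triangle inequality adds the
  steps up.
\<close>

lemma lipschitz_in_args_sum:
  assumes f: "f \<in> args d m \<rightarrow> carrier_vec n"
    and lip: "\<And>l. l < m \<Longrightarrow> lipschitz_in_arg (args d m) l (c l) f"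
    and z: "z \<in> args d m" and w: "w \<in> args d m"
  shows "vnorm (f z - f w) \<le> (\<Sum>l<m. c l * vnorm (z l - w l))"
proof -
  define h where "h k = (\<lambda>l. if l < k then w l else z l)" for k
  have h: "h k \<in> args d m" for k
    using z w unfolding args_def h_def by (auto simp: PiE_iff extensional_def)
  have "vnorm (f z - f (h k)) \<le> (\<Sum>l<k. c l * vnorm (z l - w l))" if "k \<le> m" for k
    using that
  proof (induction k)
    case 0
    have "h 0 = z"
      by (simp add: h_def)
    then show ?case
      by (simp add: vnorm_minus_self)
  next
    case (Suc k)
    have "vnorm (f z - f (h (Suc k)))
        \<le> vnorm (f z - f (h k)) + vnorm (f (h k) - f (h (Suc k)))"
      using f z h by (intro vnorm_triangle_diff[where n = n]) auto
    moreover have "vnorm (f (h k) - f (h (Suc k))) \<le> c k * vnorm (h k k - h (Suc k) k)"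
    proof -
      have "\<forall>l. l \<noteq> k \<longrightarrow> h k l = h (Suc k) l"
        by (auto simp: h_def)
      then show ?thesis
        using lip[of k] Suc.prems h unfolding lipschitz_in_arg_def by auto
    qed
    ultimately show ?case
      using Suc by (simp add: h_def)
  qed
  from this[of m] have "vnorm (f z - f (h m)) \<le> (\<Sum>l<m. c l * vnorm (z l - w l))"
    by simp
  moreover have "h m = w"
    using z w unfolding args_def h_def by (auto simp: PiE_iff extensional_def)
  ultimately show ?thesis
    by simp
qed

section \<open>Recursively computed tuples\<close>

lemma chain_in_args:
  assumes "x \<in> carrier_vec (d 0)"
    and "\<And>j z. j \<in> {1..m} \<Longrightarrow> z \<in> args d j \<Longrightarrow> S j z \<in> carrier_vec (d j)"
  shows "chain S x m \<in> args d (Suc m)"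
  using assms(2)
proof (induction m)
  case 0
  show ?case
    using assms(1) by (auto simp: args_def PiE_iff extensional_def)
next
  case (Suc m)
  then have IH: "chain S x m \<in> args d (Suc m)"
    by simp
  then have "S (Suc m) (chain S x m) \<in> carrier_vec (d (Suc m))"
    using Suc.prems by simp
  then show ?case
    using IH by (auto simp: args_def PiE_iff extensional_def less_Suc_eq)
qed

lemma chain_stable:
  assumes "j \<le> m" "m \<le> k"
  shows "chain S x k j = chain S x m j"
  using assms(2) by (induction k rule: dec_induct) (use assms(1) in auto)

lemma chain_entry:
  assumes "0 < j" "j \<le> k"
  shows "chain S x k j = S j (chain S x (j - 1))"
  using chain_stable[of j j k S x] assms by (cases j) auto

lemma chain_fun_upd_before:
  assumes "m < i"
  shows "chain (S(i := R)) x m = chain S x m"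
  using assms by (induction m) auto

section \<open>Propagation along decreasing index sequences\<close>

definition path_weight :: "(nat \<Rightarrow> nat \<Rightarrow> real) \<Rightarrow> nat list \<Rightarrow> real" where
  "path_weight K \<sigma> = (\<Prod>m = 1..length \<sigma> - 1. K (\<sigma> ! (m - 1)) (\<sigma> ! m))"

definition gain :: "(nat \<Rightarrow> nat \<Rightarrow> real) \<Rightarrow> nat \<Rightarrow> nat \<Rightarrow> real" where
  "gain K i j = (\<Sum>\<sigma>\<in>dec_seqs i j. path_weight K \<sigma>)"

lemma path_weight_Cons:
  assumes "\<tau> \<noteq> []"
  shows "path_weight K (j # \<tau>) = K j (hd \<tau>) * path_weight K \<tau>"
proof -
  obtain n where n: "length \<tau> = Suc n"
    using assms by (cases \<tau>) auto
  have "path_weight K (j # \<tau>) = (\<Prod>m = 1..Suc n. K ((j # \<tau>) ! (m - 1)) ((j # \<tau>) ! m))"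
    by (simp add: path_weight_def n)
  also have "\<dots> = K j (\<tau> ! 0) * (\<Prod>m = Suc 1..Suc n. K ((j # \<tau>) ! (m - 1)) ((j # \<tau>) ! m))"
    by (subst prod.atLeast_Suc_atMost) auto
  also have "(\<Prod>m = Suc 1..Suc n. K ((j # \<tau>) ! (m - 1)) ((j # \<tau>) ! m))
      = (\<Prod>m = 1..n. K ((j # \<tau>) ! m) (\<tau> ! m))"
    by (subst prod.shift_bounds_cl_Suc_ivl) simp
  also have "\<dots> = path_weight K \<tau>"
    unfolding path_weight_def n by (intro prod.cong) (auto simp: nth_Cons')
  finally show ?thesis
    using assms by (simp add: hd_conv_nth)
qed

lemma dec_seqs_bounds:
  assumes "\<sigma> \<in> dec_seqs i j"
  shows "i \<le> j" and "i = j \<longleftrightarrow> \<sigma> = [i]"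
proof -
  obtain \<tau> where \<sigma>: "\<sigma> = j # \<tau>"
    using assms by (cases \<sigma>) (auto simp: dec_seqs_def)
  have "i < j" if "\<tau> \<noteq> []"
    using assms \<sigma> that last_in_set[OF that] by (auto simp: dec_seqs_def)
  moreover have "i = j" if "\<tau> = []"
    using assms \<sigma> that by (auto simp: dec_seqs_def)
  ultimately show "i \<le> j" "i = j \<longleftrightarrow> \<sigma> = [i]"
    using \<sigma> by (cases "\<tau> = []"; force)+
qed

lemma dec_seqs_self: "dec_seqs i i = {[i]}"
  using dec_seqs_bounds(2)[of _ i i] by (auto simp: dec_seqs_def)

lemma dec_seqs_step:
  assumes "i < j"
  shows "dec_seqs i j = (\<Union>l\<in>{i..<j}. (#) j ` dec_seqs i l)"
proof (intro subset_antisym subsetI)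
  fix \<sigma> assume \<sigma>: "\<sigma> \<in> dec_seqs i j"
  then obtain l \<tau> where \<tau>: "\<sigma> = j # l # \<tau>"
    using assms dec_seqs_bounds(2)[OF \<sigma>]
    by (cases \<sigma>; cases "tl \<sigma>") (auto simp: dec_seqs_def)
  then have "l # \<tau> \<in> dec_seqs i l" "l < j"
    using \<sigma> by (auto simp: dec_seqs_def)
  then show "\<sigma> \<in> (\<Union>l\<in>{i..<j}. (#) j ` dec_seqs i l)"
    using \<tau> dec_seqs_bounds(1)[of "l # \<tau>" i l] by auto
next
  fix \<sigma> assume "\<sigma> \<in> (\<Union>l\<in>{i..<j}. (#) j ` dec_seqs i l)"
  then obtain l \<tau> where *: "l < j" "\<tau> \<in> dec_seqs i l" "\<sigma> = j # \<tau>"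
    by auto
  moreover obtain \<tau>' where "\<tau> = l # \<tau>'"
    using * by (cases \<tau>) (auto simp: dec_seqs_def)
  ultimately show "\<sigma> \<in> dec_seqs i j"
    by (auto simp: dec_seqs_def)
qed

lemma finite_dec_seqs: "finite (dec_seqs i j)"
proof (induction j rule: less_induct)
  case (less j)
  consider "i < j" | "i = j" | "j < i"
    by linarith
  then show ?case
  proof cases
    case 1
    then show ?thesis
      using less by (simp add: dec_seqs_step)
  next
    case 2
    then show ?thesis
      by (simp add: dec_seqs_self)
  next
    case 3
    then have "dec_seqs i j = {}"
      using dec_seqs_bounds(1)[of _ i j] by fastforce
    then show ?thesis
      by simp
  qed
qed

lemma gain_self: "gain K i i = 1"
  by (simp add: gain_def dec_seqs_self path_weight_def)

text \<open>
  Splitting off the first step \<open>j \<rightarrow> l\<close> of a sequence turns the closed sum over sequences into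
  the recursion that the errors satisfy.
\<close>

lemma gain_rec:
  assumes "i < j"
  shows "gain K i j = (\<Sum>l = i..<j. K j l * gain K i l)"
proof -
  have disj: "(#) j ` dec_seqs i l \<inter> (#) j ` dec_seqs i l' = {}" if "l \<noteq> l'" for l l'
    using that by (auto simp: dec_seqs_def)
  have "gain K i j = (\<Sum>l = i..<j. \<Sum>\<sigma>\<in>(#) j ` dec_seqs i l. path_weight K \<sigma>)"
    unfolding gain_def dec_seqs_step[OF assms]
    using disj by (intro sum.UNION_disjoint) (auto simp: finite_dec_seqs)
  also have "\<dots> = (\<Sum>l = i..<j. \<Sum>\<tau>\<in>dec_seqs i l. K j l * path_weight K \<tau>)"
  proof (rule sum.cong[OF refl])
    fix l
    have "(\<Sum>\<sigma>\<in>(#) j ` dec_seqs i l. path_weight K \<sigma>)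
        = (\<Sum>\<tau>\<in>dec_seqs i l. path_weight K (j # \<tau>))"
      by (subst sum.reindex) (auto simp: inj_on_def)
    also have "\<dots> = (\<Sum>\<tau>\<in>dec_seqs i l. K j l * path_weight K \<tau>)"
      by (intro sum.cong refl) (auto simp: dec_seqs_def path_weight_Cons)
    finally show "(\<Sum>\<sigma>\<in>(#) j ` dec_seqs i l. path_weight K \<sigma>)
        = (\<Sum>\<tau>\<in>dec_seqs i l. K j l * path_weight K \<tau>)" .
  qed
  finally show ?thesis
    by (simp add: gain_def sum_distrib_left)
qed

lemma gain_nonneg:
  assumes "i \<le> j"
    and "\<And>m l. i < m \<Longrightarrow> m \<le> j \<Longrightarrow> i \<le> l \<Longrightarrow> l < m \<Longrightarrow> 0 \<le> K m l"
  shows "0 \<le> gain K i j"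
  using assms
proof (induction j rule: less_induct)
  case (less j)
  show ?case
  proof (cases "i = j")
    case True
    then show ?thesis
      by (simp add: gain_self)
  next
    case False
    then have "i < j"
      using less.prems by simp
    then show ?thesis
      unfolding gain_rec[OF \<open>i < j\<close>] using less
      by (intro sum_nonneg mult_nonneg_nonneg) auto
  qed
qed

text \<open>
  A discrete Gronwall inequality: as \<open>K\<close> is nonnegative, a subsolution of the recursion
  \<open>gain_rec\<close> stays below the exact solution with the same value at \<open>i\<close>.
\<close>

lemma gain_gronwall:
  fixes e :: "nat \<Rightarrow> real"
  assumes K: "\<And>m l. i < m \<Longrightarrow> m \<le> p \<Longrightarrow> i \<le> l \<Longrightarrow> l < m \<Longrightarrow> 0 \<le> K m l"
    and e: "\<And>m. i < m \<Longrightarrow> m \<le> p \<Longrightarrow> e m \<le> (\<Sum>l = i..<m. K m l * e l)"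
    and "i \<le> j" "j \<le> p"
  shows "e j \<le> gain K i j * e i"
  using assms(3,4)
proof (induction j rule: less_induct)
  case (less j)
  show ?case
  proof (cases "i = j")
    case True
    then show ?thesis
      by (simp add: gain_self)
  next
    case False
    then have ij: "i < j"
      using less.prems by simp
    have "e j \<le> (\<Sum>l = i..<j. K j l * e l)"
      using e ij less.prems by simp
    also have "\<dots> \<le> (\<Sum>l = i..<j. K j l * (gain K i l * e i))"
      using less ij K by (intro sum_mono mult_left_mono) auto
    also have "\<dots> = gain K i j * e i"
      by (simp add: gain_rec[OF ij] sum_distrib_right mult.assoc)
    finally show ?thesis .
  qed
qed

section \<open>The error bound\<close>

theorem theorem3p2:
  fixes p i P :: nat
    and d :: "nat \<Rightarrow> nat"
    and \<phi> :: "(nat \<Rightarrow> real vec) \<Rightarrow> real vec"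
    and A :: "nat \<Rightarrow> (nat \<Rightarrow> real vec) \<Rightarrow> real mat"
    and F :: "nat \<Rightarrow> (nat \<Rightarrow> real vec) \<Rightarrow> real vec"
    and L :: "nat \<Rightarrow> real"
    and K :: "nat \<Rightarrow> nat \<Rightarrow> real"
    and V :: "real mat"
    and ub :: "real vec"
    and \<alpha> :: "(nat \<Rightarrow> real vec) \<Rightarrow> real vec"
    and x :: "real vec"
  defines "G \<equiv> composite \<phi> (sol_map A F) p"
    and "Gk \<equiv> inexact \<phi> (sol_map A F) p i (rom_map V ub \<alpha>)"
    and "\<mu> \<equiv> chain (sol_map A F) x (i - 1)"
  assumes "p \<ge> 1"
    and "\<phi> \<in> args d (p + 1) \<rightarrow> carrier_vec (d 0)"
    and "\<And>j z. j \<in> {1..p} \<Longrightarrow> z \<in> args d j \<Longrightarrow>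
           A j z \<in> carrier_mat (d j) (d j) \<and> invertible_mat (A j z)"
    and "\<And>j z. j \<in> {1..p} \<Longrightarrow> z \<in> args d j \<Longrightarrow> F j z \<in> carrier_vec (d j)"
    and "\<And>j. j \<in> {0..p} \<Longrightarrow> lipschitz_in_arg (args d (p + 1)) j (L j) \<phi>"
    and "\<And>j l. j \<in> {1..p} \<Longrightarrow> l \<in> {0..<j} \<Longrightarrow>
           lipschitz_in_arg (args d j) l (K j l) (sol_map A F j)"
    and "i \<in> {1..p}"
    and "x \<in> carrier_vec (d 0)"
    and "V \<in> carrier_mat (d i) P"
    and "ub \<in> carrier_vec (d i)"
    and "solves_reduced (A i \<mu>) (F i \<mu>) V ub (\<alpha> \<mu>)"
  shows "vnorm (G x - Gk x)
           \<le> error_bound L K i p (A i \<mu>) (residual A F i \<mu> (rom_map V ub \<alpha> \<mu>))"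
proof -
  note A = assms(6) and F = assms(7) and lip_phi = assms(8) and lip_S = assms(9)
  define S where "S = sol_map A F"
  define R where "R = rom_map V ub \<alpha>"
  define u where "u = chain S x"
  define v where "v = chain (S(i := R)) x"
  define e where "e l = vnorm (u p l - v p l)" for l
  have i: "1 \<le> i" "i \<le> p"
    using \<open>i \<in> {1..p}\<close> by auto
  have S: "S j z \<in> carrier_vec (d j)" if "j \<in> {1..p}" "z \<in> args d j" for j z
    unfolding S_def sol_map_def using A[OF that] F[OF that] minv_inverse(1)[of "A j z" "d j"]
    by (auto intro: mult_mat_vec_carrier)
  have R: "R z \<in> carrier_vec (d i)" for z
    using assms(12,13) by (auto simp: R_def rom_map_def intro!: carrier_vecI)
  have u_args: "u m \<in> args d (Suc m)" and v_args: "v m \<in> args d (Suc m)" if "m \<le> p" for m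
    unfolding u_def v_def using S R that \<open>x \<in> carrier_vec (d 0)\<close> by (auto intro!: chain_in_args)
  have mu: "\<mu> = u (i - 1)" "\<mu> = v (i - 1)"
    using i by (auto simp: assms(3) u_def v_def S_def chain_fun_upd_before)
  have mu_args: "\<mu> \<in> args d i"
    using u_args[of "i - 1"] mu(1) i by simp

  have e_before: "e l = 0" if "l < i" for l
  proof -
    have "u p l = \<mu> l"
      using that i unfolding mu(1) u_def by (intro chain_stable) auto
    moreover have "v p l = \<mu> l"
      using that i unfolding mu(2) v_def by (intro chain_stable) auto
    ultimately show ?thesis
      by (simp add: e_def vnorm_minus_self)
  qed
  have e_at: "e i \<le> opnorm (minv (A i \<mu>)) * vnorm (residual A F i \<mu> (R \<mu>))"
  proof -
    have "u p i = minv (A i \<mu>) *\<^sub>v F i \<mu>"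
      using i mu(1) by (simp add: u_def chain_entry S_def sol_map_def)
    moreover have "v p i = R \<mu>"
      using i mu(2) by (simp add: v_def chain_entry)
    ultimately show ?thesis
      unfolding e_def residual_def
      using A[OF \<open>i \<in> {1..p}\<close> mu_args] F[OF \<open>i \<in> {1..p}\<close> mu_args] R
      by (auto intro: solution_error_le_residual)
  qed
  have K: "0 \<le> K m l" if "i < m" "m \<le> p" "i \<le> l" "l < m" for m l
    using lip_S[of m l] that by (auto simp: lipschitz_in_arg_def)
  have L: "0 \<le> L m" if "m \<le> p" for m
    using lip_phi[of m] that by (auto simp: lipschitz_in_arg_def)

  have e_after: "e m \<le> (\<Sum>l = i..<m. K m l * e l)" if m: "i < m" "m \<le> p" for m
  proof -
    have args: "u (m - 1) \<in> args d m" "v (m - 1) \<in> args d m"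
      using u_args[of "m - 1"] v_args[of "m - 1"] m by auto
    have earlier: "u (m - 1) l = u p l" "v (m - 1) l = v p l" if "l < m" for l
      using chain_stable[of l "m - 1" p] that m by (simp_all add: u_def v_def)
    have "u p m = S m (u (m - 1))" "v p m = S m (v (m - 1))"
      using m i by (simp_all add: u_def v_def chain_entry)
    then have "e m = vnorm (S m (u (m - 1)) - S m (v (m - 1)))"
      by (simp add: e_def)
    also have "\<dots> \<le> (\<Sum>l<m. K m l * vnorm (u (m - 1) l - v (m - 1) l))"
      using m i S lip_S args unfolding S_def
      by (intro lipschitz_in_args_sum[where d = d and n = "d m"]) auto
    also have "\<dots> = (\<Sum>l<m. K m l * e l)"
      using earlier by (intro sum.cong) (auto simp: e_def)
    also have "\<dots> = (\<Sum>l = i..<m. K m l * e l)"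
      using e_before by (intro sum.mono_neutral_right) auto
    finally show ?thesis .
  qed

  have "vnorm (G x - Gk x) = vnorm (\<phi> (u p) - \<phi> (v p))"
    by (simp add: assms(1,2) inexact_def composite_def u_def v_def S_def R_def)
  also have "\<dots> \<le> (\<Sum>l<p + 1. L l * e l)"
    unfolding e_def using lip_phi u_args[of p] v_args[of p] assms(5)
    by (intro lipschitz_in_args_sum[where d = d and n = "d 0"]) auto
  \<comment> \<open>The perturbation leaves \<open>x\<close> and the solutions before \<open>i\<close> unchanged.\<close>
  also have "\<dots> = (\<Sum>l = i..p. L l * e l)"
    using e_before by (intro sum.mono_neutral_right) auto
  also have "\<dots> \<le> (\<Sum>l = i..p. L l * (gain K i l * e i))"
    using L K e_after by (intro sum_mono mult_left_mono gain_gronwall[where p = p]) auto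
  also have "\<dots> = (\<Sum>l = i..p. L l * gain K i l) * e i"
    by (simp add: sum_distrib_right mult.assoc)
  also have "\<dots> \<le> (\<Sum>l = i..p. L l * gain K i l)
      * (opnorm (minv (A i \<mu>)) * vnorm (residual A F i \<mu> (R \<mu>)))"
    using L K e_at
    by (intro mult_right_mono mult_left_mono sum_nonneg mult_nonneg_nonneg gain_nonneg) auto
  also have "(\<Sum>l = i..p. L l * gain K i l) = L i + (\<Sum>l = i+1..p. L l * gain K i l)"
    using i by (simp add: sum.atLeast_Suc_atMost gain_self)
  finally show ?thesis
    by (simp add: error_bound_def gain_def path_weight_def R_def mult.assoc)
qed

end
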